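(* For every $y\in R^\infty$ and every $t\geq 1$, \[ \delta_1(y;t) = \sum_{j=0}^{\lfloor \frac{t-3}{4}\rfloor}\ \sum_{i =-1}^{t-4j-4}P(y,1,i)\, V_1(y,i+2,i+3+4j)\, U(y,i+5+4j,t) \;+\; \sum_{i=0}^{\lfloor \frac{t-2}{4}\rfloor} V_1(y,1,4i+1)\, U(y,4i+3, t), \] where $P(y,1,-1) = P(y,1,0) = U(y,t+1,t) = 1$ and a sum whose upper limit is less than its lower limit is $0$.
   Context: Fix a positive integer $n$ and let $R = \mathbb{F}_2[x_1,\ldots,x_n]/\langle x_i^2 - x_i : 1 \leq i \leq n\rangle$. Let $R^\infty$ be the set of sequences $y=(y(i))_{i=1}^\infty$ of elements of $R$. Empty products are $1$. For $u,v\in R^\infty$, the carry sequence $c(u,v)=(c(u,v;i))_{i=1}^\infty$ is defined by $c(u,v;1)=0$ and $c(u,v;i+1)=u(i)v(i)+c(u,v;i)(u(i)+v(i))$ for $i\ge 1$. For $y\in R^\infty$: $P(y;j)=\prod_{i=1}^{j}(1+y(i))$ (with $P(y;0)=1$); $\mathrm{PlusPowerTwo}(y) = (y(j)P(y;j-1))_{j=1}^\infty$; and $\gamma(y)=(\gamma(y;j))_{j=1}^\infty$ is the carry sequence for $y$ and $\mathrm{PlusPowerTwo}(y)$, i.e. $\gamma(y;j)=c(y,\mathrm{PlusPowerTwo}(y);j)$. For $j\ge 1$ define \[ \delta_1(y; j) = \sum_{k=0}^{j-1} \gamma(y;j-k) \prod_{i=1}^k \bigl(y(j-i+1)+y(j-i)\bigr).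 \] For $1\le a\le b$ define \[ U(y,a,b)=\prod_{i=1}^{b-a+1}y(b-i+1),\qquad P(y,a,b)=\prod_{i=1}^{b-a+1}(1+y(b-i+1)), \] \[ V_1(y,a,b)=\prod_{i=1}^{b-a+1}\bigl(y(b-i+1)+\mathbf{1}(i\equiv 0 \pmod 2)\bigr), \] where $\mathbf{1}(\cdot)\in\{0,1\}$ is the indicator of the stated condition, regarded as an element of $R$; thus $V_1(y,a,b)=y(b)(1+y(b-1))y(b-2)(1+y(b-3))\cdots$, ending with the factor involving $y(a)$. *)

theory Defs
  imports Complex_Main "HOL-Library.Poly_Mapping" "HOL-Library.Z2"
begin

section \<open>The ring \<open>\<bbbF>\<^sub>2[x\<^sub>1,\<dots>,x\<^sub>n]/\<langle>x\<^sub>i\<^sup>2 - x\<^sub>i\<rangle>\<close>\<close>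

text \<open>
  Polynomials over the two-element field in variables indexed by \<open>'n\<close>: a polynomial maps
  exponent vectors \<open>'n \<Rightarrow>\<^sub>0 nat\<close> to coefficients. For \<open>n\<close> variables, take \<open>'n\<close> finite with
  \<open>CARD('n) = n\<close>; the construction itself does not need finiteness.
\<close>

type_synonym 'n f2_poly = "('n \<Rightarrow>\<^sub>0 nat) \<Rightarrow>\<^sub>0 bit"

definition poly_var :: "'n \<Rightarrow> 'n f2_poly" where
  "poly_var i = Poly_Mapping.single (Poly_Mapping.single i 1) 1"

lemma module_times: "module ((*) :: 'a::comm_ring_1 \<Rightarrow> 'a \<Rightarrow> 'a)"
  by unfold_locales (simp_all add: algebra_simps)

text \<open>The ideal generated by a set is its span in the ring regarded as a module over itself.\<close>

definition boolean_ideal :: "'n f2_poly set" where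
  "boolean_ideal = module.span (*) (range (\<lambda>i. poly_var i ^ 2 - poly_var i))"

lemmas boolean_ideal_zero =
  module.span_zero [OF module_times, of "range (\<lambda>i. poly_var i ^ 2 - poly_var i)",
    folded boolean_ideal_def]

lemmas boolean_ideal_add =
  module.span_add [OF module_times, of _ "range (\<lambda>i. poly_var i ^ 2 - poly_var i)",
    folded boolean_ideal_def]

lemmas boolean_ideal_neg =
  module.span_neg [OF module_times, of _ "range (\<lambda>i. poly_var i ^ 2 - poly_var i)",
    folded boolean_ideal_def]

lemmas boolean_ideal_mult =
  module.span_scale [OF module_times, of _ "range (\<lambda>i. poly_var i ^ 2 - poly_var i)",
    folded boolean_ideal_def]

lemma lookup_mult_at_0:
  fixes p q :: "'n f2_poly"
  assumes "Poly_Mapping.lookup q 0 = 0"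
  shows "Poly_Mapping.lookup (p * q) 0 = 0"
proof -
  have "(Poly_Mapping.lookup q b when 0 = a + b) = 0" for a b :: "'n \<Rightarrow>\<^sub>0 nat"
  proof (cases "0 = a + b")
    case True
    have "b = 0"
    proof (rule poly_mapping_eqI)
      fix k
      have "Poly_Mapping.lookup a k + Poly_Mapping.lookup b k = 0"
        using True by (metis lookup_add lookup_zero)
      then show "Poly_Mapping.lookup b k = Poly_Mapping.lookup 0 k" by simp
    qed
    then show ?thesis using assms by simp
  qed simp
  then show ?thesis by (simp add: lookup_mult)
qed

lemma one_notin_boolean_ideal: "1 \<notin> boolean_ideal"
proof
  let ?S = "{p :: 'a f2_poly. Poly_Mapping.lookup p 0 = 0}"
  have "poly_var i ^ 2 - poly_var i \<in> ?S" for i :: 'a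
  proof -
    have "Poly_Mapping.single i (1 :: nat) \<noteq> 0"
      by (metis lookup_single_eq lookup_zero one_neq_zero)
    then have "Poly_Mapping.lookup (poly_var i) 0 = 0"
      by (simp add: poly_var_def lookup_single_not_eq)
    then show ?thesis
      by (simp add: power2_eq_square lookup_minus lookup_mult_at_0)
  qed
  moreover have "module.subspace (*) ?S"
    by (auto simp: module.subspace_def [OF module_times] lookup_add lookup_mult_at_0)
  ultimately have "boolean_ideal \<subseteq> ?S"
    unfolding boolean_ideal_def by (intro module.span_minimal [OF module_times]) auto
  moreover assume "(1 :: 'a f2_poly) \<in> boolean_ideal"
  ultimately show False by auto
qed

definition boolean_rel :: "'n f2_poly \<Rightarrow> 'n f2_poly \<Rightarrow> bool" where
  "boolean_rel p q \<longleftrightarrow> p - q \<in> boolean_ideal"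

quotient_type 'n boolean_poly = "'n f2_poly" / boolean_rel
proof (rule equivpI)
  show "reflp (boolean_rel :: 'n f2_poly \<Rightarrow> _)"
    by (simp add: reflp_def boolean_rel_def boolean_ideal_zero)
  show "symp (boolean_rel :: 'n f2_poly \<Rightarrow> _)"
    using boolean_ideal_neg by (force simp: symp_def boolean_rel_def)
  show "transp (boolean_rel :: 'n f2_poly \<Rightarrow> _)"
    using boolean_ideal_add by (force simp: transp_def boolean_rel_def)
qed

instantiation boolean_poly :: (type) comm_ring_1
begin

lift_definition zero_boolean_poly :: "'a boolean_poly" is 0 .

lift_definition one_boolean_poly :: "'a boolean_poly" is 1 .

lift_definition plus_boolean_poly :: "'a boolean_poly \<Rightarrow> 'a boolean_poly \<Rightarrow> 'a boolean_poly"
  is "(+)"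
  unfolding boolean_rel_def by (metis add_diff_add boolean_ideal_add)

lift_definition uminus_boolean_poly :: "'a boolean_poly \<Rightarrow> 'a boolean_poly" is uminus
  unfolding boolean_rel_def by (metis boolean_ideal_neg minus_diff_minus)

lift_definition minus_boolean_poly :: "'a boolean_poly \<Rightarrow> 'a boolean_poly \<Rightarrow> 'a boolean_poly"
  is "(-)"
  unfolding boolean_rel_def
  by (metis (no_types, opaque_lifting) boolean_ideal_add boolean_ideal_neg add_diff_add
      diff_conv_add_uminus minus_diff_minus)

lift_definition times_boolean_poly :: "'a boolean_poly \<Rightarrow> 'a boolean_poly \<Rightarrow> 'a boolean_poly"
  is "(*)"
proof -
  fix p p' q q' :: "'a f2_poly"
  assume "boolean_rel p p'" "boolean_rel q q'"
  then have "q * (p - p') + p' * (q - q') \<in> boolean_ideal"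
    unfolding boolean_rel_def by (intro boolean_ideal_add boolean_ideal_mult)
  moreover have "q * (p - p') + p' * (q - q') = p * q - p' * q'"
    by (simp add: algebra_simps)
  ultimately show "boolean_rel (p * q) (p' * q')"
    unfolding boolean_rel_def by simp
qed

instance
proof
  show "(0 :: 'a boolean_poly) \<noteq> 1"
    by transfer (use boolean_ideal_neg one_notin_boolean_ideal in \<open>force simp: boolean_rel_def\<close>)
qed (transfer; simp add: boolean_rel_def boolean_ideal_zero algebra_simps)+

end


section \<open>Carry sequences\<close>

text \<open>
  A sequence \<open>(y(i))\<^bsub>i \<ge> 1\<^esub>\<close> is a function on \<open>nat\<close> whose value at \<open>0\<close> is irrelevant:
  none of the notions below, taken at an index \<open>\<ge> 1\<close>, evaluates \<open>y\<close> at \<open>0\<close>.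
\<close>

fun carry :: "(nat \<Rightarrow> 'a::comm_ring_1) \<Rightarrow> (nat \<Rightarrow> 'a) \<Rightarrow> nat \<Rightarrow> 'a" where
  "carry u v 0 = 0"
| "carry u v (Suc i) =
    (if i = 0 then 0 else u i * v i + carry u v i * (u i + v i))"

definition prefix_prod :: "(nat \<Rightarrow> 'a::comm_ring_1) \<Rightarrow> nat \<Rightarrow> 'a" where
  "prefix_prod y j = (\<Prod>i=1..j. 1 + y i)"

definition plus_power_two :: "(nat \<Rightarrow> 'a::comm_ring_1) \<Rightarrow> nat \<Rightarrow> 'a" where
  "plus_power_two y j = y j * prefix_prod y (j - 1)"

definition gamma :: "(nat \<Rightarrow> 'a::comm_ring_1) \<Rightarrow> nat \<Rightarrow> 'a" where
  "gamma y = carry y (plus_power_two y)"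

definition delta1 :: "(nat \<Rightarrow> 'a::comm_ring_1) \<Rightarrow> nat \<Rightarrow> 'a" where
  "delta1 y j = (\<Sum>k<j. gamma y (j - k) * (\<Prod>i=1..k. y (j - i + 1) + y (j - i)))"


section \<open>Interval products\<close>

text \<open>
  The bounds are integers, as empty products with upper bound \<open>-1\<close> are needed. Whenever
  \<open>b < a\<close> the index range is empty and the product is \<open>1\<close>; in particular
  \<open>Pprod y 1 (-1) = Pprod y 1 0 = Uprod y (t + 1) t = 1\<close>. For \<open>1 \<le> a \<le> b\<close> all arguments
  of \<open>nat\<close> are positive.
\<close>

definition Uprod :: "(nat \<Rightarrow> 'a::comm_ring_1) \<Rightarrow> int \<Rightarrow> int \<Rightarrow> 'a" where
  "Uprod y a b = (\<Prod>i=1..b - a + 1. y (nat (b - i + 1)))"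

definition Pprod :: "(nat \<Rightarrow> 'a::comm_ring_1) \<Rightarrow> int \<Rightarrow> int \<Rightarrow> 'a" where
  "Pprod y a b = (\<Prod>i=1..b - a + 1. 1 + y (nat (b - i + 1)))"

definition V1prod :: "(nat \<Rightarrow> 'a::comm_ring_1) \<Rightarrow> int \<Rightarrow> int \<Rightarrow> 'a" where
  "V1prod y a b = (\<Prod>i=1..b - a + 1. y (nat (b - i + 1)) + of_bool (i mod 2 = 0))"

end

theory Submission
  imports Defs
begin

text \<open>
  Let \<open>F(t)\<close> be the right-hand side and \<open>E(t)\<close> the sum of its terms with empty factor \<open>U\<close>, so
  that \<open>F(t+1) = y(t+1) F(t) + E(t+1)\<close>. As the left-hand side satisfies
  \<open>\<delta>\<^sub>1(t+1) = \<gamma>(t+1) + (y(t+1) + y(t)) \<delta>\<^sub>1(t)\<close>, it suffices that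
  \<open>E(t+1) = \<gamma>(t+1) + y(t) (F(t-1) + E(t))\<close>. Splitting off the last four factors of \<open>V\<^sub>1\<close> gives a
  four-step recurrence for \<open>E\<close>, which in a Boolean ring is the second iterate of
  \<open>E(t+2) = y(t+1) (P(t) + (1 + y(t)) E(t))\<close>. Together with
  \<open>\<gamma>(t+1) = y(t) (P(t-1) + \<gamma>(t))\<close> this two-step recurrence yields the claim by induction.
\<close>

section \<open>Boolean rings, and why the quotient ring is one\<close>

class boolean_ring = comm_ring_1 +
  assumes mult_self [simp]: "x * x = x"
begin

lemma add_self [simp]: "x + x = 0"
proof -
  have "(x + x) * (x + x) = x + x"
    by (rule mult_self)
  moreover have "(x + x) * (x + x) = (x + x) + (x + x)"
    unfolding distrib_left distrib_right by (simp only: mult_self)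
  ultimately show ?thesis
    by (metis add_cancel_right_right)
qed

lemma add_self_left [simp]: "x + (x + z) = z"
  by (simp flip: add.assoc)

lemma mult_self_left [simp]: "x * (x * z) = x * z"
  by (simp flip: mult.assoc)

end

lemma f2_poly_add_self: "p + p = (0 :: 'n f2_poly)"
  by (rule poly_mapping_eqI) (simp only: lookup_add lookup_zero add_bit_eq_xor xor_self_eq)

text \<open>Idempotency of a residue class, stated on representatives so that induction on
  polynomials applies.\<close>

definition idem_mod :: "'n f2_poly \<Rightarrow> bool" where
  "idem_mod p \<longleftrightarrow> p * p - p \<in> boolean_ideal"

lemma idem_mod_add:
  assumes "idem_mod p" "idem_mod q"
  shows "idem_mod (p + q)"
proof -
  have "(p + q) * (p + q) - (p + q) = (p * p - p) + (q * q - q) + (p * q + p * q)"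
    by (simp only: algebra_simps)
  also have "\<dots> = (p * p - p) + (q * q - q)"
    by (simp only: f2_poly_add_self add_0_right)
  finally show ?thesis
    using assms by (simp only: idem_mod_def boolean_ideal_add)
qed

lemma idem_mod_mult:
  assumes "idem_mod p" "idem_mod q"
  shows "idem_mod (p * q)"
proof -
  have "(p * q) * (p * q) - p * q = (q * q) * (p * p - p) + p * (q * q - q)"
    by (simp add: algebra_simps)
  then show ?thesis
    using assms by (simp add: idem_mod_def boolean_ideal_add boolean_ideal_mult)
qed

lemma idem_mod_0: "idem_mod 0"
  by (simp add: idem_mod_def boolean_ideal_zero)

lemma idem_mod_1: "idem_mod 1"
  by (simp add: idem_mod_def boolean_ideal_zero)

lemma idem_mod_poly_var: "idem_mod (poly_var i)"
  unfolding idem_mod_def boolean_ideal_def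
  by (rule module.span_base [OF module_times]) (auto simp: power2_eq_square)

lemma idem_mod_single_single: "idem_mod (Poly_Mapping.single (Poly_Mapping.single i k) 1)"
proof (induction k)
  case 0
  then show ?case
    using idem_mod_1 by (simp add: single_one)
next
  case (Suc k)
  have "Poly_Mapping.single (Poly_Mapping.single i (Suc k)) (1 :: bit) =
      poly_var i * Poly_Mapping.single (Poly_Mapping.single i k) 1"
    by (simp add: poly_var_def mult_single flip: single_add)
  then show ?case
    by (simp add: idem_mod_mult idem_mod_poly_var Suc)
qed

lemma idem_mod_single: "idem_mod (Poly_Mapping.single m 1)"
proof (induction m rule: update_induct)
  case const
  then show ?case
    using idem_mod_1 by (simp add: single_one)
next
  case (update m i k)
  have "Poly_Mapping.update i k m = Poly_Mapping.single i k + m"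
    using update(1) by (intro poly_mapping_eqI)
      (auto simp: lookup_update lookup_add lookup_single when_def in_keys_iff)
  then have "Poly_Mapping.single (Poly_Mapping.update i k m) (1 :: bit) =
      Poly_Mapping.single (Poly_Mapping.single i k) 1 * Poly_Mapping.single m 1"
    by (simp add: mult_single)
  then show ?case
    by (simp add: idem_mod_mult idem_mod_single_single update)
qed

text \<open>Every polynomial is a sum of monomials, as the only nonzero coefficient is 1, and each
  monomial is a product of variables.\<close>

lemma idem_mod_all: "idem_mod p"
proof (induction p rule: update_induct)
  case const
  then show ?case
    by (rule idem_mod_0)
next
  case (update p m c)
  have "Poly_Mapping.update m c p = Poly_Mapping.single m c + p"
    using update(1) by (intro poly_mapping_eqI)
      (auto simp: lookup_update lookup_add lookup_single when_def in_keys_iff)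
  moreover have "c = 1"
    using update(2) by simp
  ultimately show ?case
    by (simp add: idem_mod_add idem_mod_single update)
qed

instance boolean_poly :: (type) boolean_ring
  by standard (transfer, use idem_mod_all in \<open>auto simp: boolean_rel_def idem_mod_def\<close>)

section \<open>Recurrences for \<open>delta1\<close> and \<open>gamma\<close>\<close>

lemma prefix_prod_0 [simp]: "prefix_prod y 0 = 1"
  by (simp add: prefix_prod_def)

lemma prefix_prod_Suc [simp]: "prefix_prod y (Suc j) = (1 + y (Suc j)) * prefix_prod y j"
  by (simp add: prefix_prod_def mult.commute)

text \<open>The summand \<open>k = 0\<close> is \<open>gamma y (Suc t)\<close>; the others share the
  factor \<open>y (Suc t) + y t\<close> and leave the summands of \<open>delta1 y t\<close>. For
  \<open>t = 0\<close> the value \<open>y 0\<close> meets an empty sum.\<close>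

lemma delta1_Suc:
  "delta1 y (Suc t) = gamma y (Suc t) + (y (Suc t) + y t) * delta1 y t"
proof -
  have "(\<Prod>i=1..Suc k. y (Suc t - i + 1) + y (Suc t - i)) =
      (y (Suc t) + y t) * (\<Prod>i=1..k. y (t - i + 1) + y (t - i))" for k
    unfolding One_nat_def prod.atLeast_Suc_atMost_Suc_shift
    by (subst prod.atLeast_Suc_atMost) (simp_all del: prod.cl_ivl_Suc add: prod.atLeast_Suc_atMost_Suc_shift)
  then show ?thesis
    unfolding delta1_def sum.lessThan_Suc_shift
    by (simp add: sum_distrib_left mult.left_commute del: prod.cl_ivl_Suc)
qed

context
  fixes y :: "nat \<Rightarrow> 'a::boolean_ring"
begin

lemma mult_one_plus_self: "x * (1 + x) = (0 :: 'a)"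
  by (simp add: distrib_left)

text \<open>The carry rule gives the first formula up to the extra term
  \<open>y t * (gamma y t * prefix_prod y (t - 1))\<close>. The second fact removes it: for t \<ge>
  2, \<open>gamma y t\<close> has the factor \<open>y (t - 1)\<close> and the prefix product the
  factor \<open>1 + y (t - 1)\<close>. Hence the joint induction.\<close>

lemma gamma_Suc: "t \<ge> 1 \<Longrightarrow> gamma y (Suc t) = y t * (prefix_prod y (t - 1) + gamma y t)"
  and gamma_mult_prefix_prod: "t \<ge> 1 \<Longrightarrow> gamma y t * prefix_prod y (t - 1) = 0"
proof (induction t)
  case (Suc t)
  have zero: "gamma y (Suc t) * prefix_prod y t = 0"
  proof (cases t)
    case 0
    then show ?thesis by (simp add: gamma_def)
  next
    case (Suc s)
    then have "gamma y (Suc t) * prefix_prod y t =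
        (y t * (1 + y t)) * ((prefix_prod y s + gamma y t) * prefix_prod y s)"
      using Suc.IH(1) by (simp add: ac_simps)
    then show ?thesis
      by (simp only: mult_one_plus_self mult_zero_left)
  qed
  have "gamma y (Suc (Suc t)) = y (Suc t) * (prefix_prod y t + gamma y (Suc t))
      + y (Suc t) * (gamma y (Suc t) * prefix_prod y t)"
    by (simp add: gamma_def plus_power_two_def distrib_left ac_simps)
  with zero show
    "gamma y (Suc (Suc t)) = y (Suc t) * (prefix_prod y (Suc t - 1) + gamma y (Suc t))"
    "gamma y (Suc t) * prefix_prod y (Suc t - 1) = 0"
    by simp_all
qed simp_all

end

section \<open>Recurrences for the interval products, whose factors are numbered from the upper
  bound down\<close>

lemma prod_int_shift:
  fixes f :: "int \<Rightarrow> 'a::comm_monoid_mult"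
  assumes "n \<ge> 0"
  shows "(\<Prod>i=1..n + 1. f i) = f 1 * (\<Prod>i=1..n. f (i + 1))"
proof -
  have "{1..n + 1} = insert 1 ((\<lambda>i. i + 1) ` {1..n})"
    using assms by (auto simp: image_def intro: bexI [of _ "_ - 1"])
  moreover have "(\<Prod>i\<in>(\<lambda>i. i + 1) ` {1..n}. f i) = (\<Prod>i=1..n. f (i + 1))"
    by (subst prod.reindex) auto
  moreover have "1 \<notin> (\<lambda>i. i + 1) ` {1..n}"
    by auto
  ultimately show ?thesis
    by (simp only: prod.insert finite_imageI finite_atLeastAtMost_int not_False_eq_True)
qed

lemma Uprod_empty: "b < a \<Longrightarrow> Uprod y a b = 1"
  by (simp add: Uprod_def)

lemma Uprod_rec:
  assumes "a \<le> b + 1"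
  shows "Uprod y a (b + 1) = y (nat (b + 1)) * Uprod y a b"
  using prod_int_shift [of "b - a + 1" "\<lambda>i. y (nat (b + 1 - i + 1))"] assms
  by (simp add: Uprod_def algebra_simps)

lemma Pprod_empty: "b < a \<Longrightarrow> Pprod y a b = 1"
  by (simp add: Pprod_def)

lemma Pprod_rec:
  assumes "a \<le> b + 1"
  shows "Pprod y a (b + 1) = (1 + y (nat (b + 1))) * Pprod y a b"
  using prod_int_shift [of "b - a + 1" "\<lambda>i. 1 + y (nat (b + 1 - i + 1))"] assms
  by (simp add: Pprod_def algebra_simps)

lemma Pprod_eq_prefix_prod: "Pprod y 1 (int t) = prefix_prod y t"
proof (induction t)
  case (Suc t)
  then show ?case
    using Pprod_rec [of 1 "int t" y] by (simp add: ac_simps nat_add_distrib)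
qed (simp add: Pprod_empty)

lemma V1prod_empty: "b < a \<Longrightarrow> V1prod y a b = 1"
  by (simp add: V1prod_def)

lemma V1prod_single: "V1prod y a a = y (nat a)"
  by (simp add: V1prod_def)

text \<open>A shift by two keeps the parity of each factor's number; a shift by one would exchange
  the two kinds of factors.\<close>

lemma V1prod_rec2:
  assumes "a \<le> b + 1"
  shows "V1prod y a (b + 2) = y (nat (b + 2)) * (1 + y (nat (b + 1))) * V1prod y a b"
proof -
  define f where "f i = y (nat (b + 2 - i + 1)) + of_bool (i mod 2 = 0)" for i
  have "V1prod y a (b + 2) = (\<Prod>i=1..(b - a + 1) + 1 + 1. f i)"
    by (simp add: V1prod_def f_def algebra_simps)
  also have "\<dots> = f 1 * (f 2 * (\<Prod>i=1..b - a + 1. f (i + 2)))"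
    using assms prod_int_shift [of "b - a + 1 + 1" f]
      prod_int_shift [of "b - a + 1" "\<lambda>i. f (i + 1)"]
    by (simp add: add.assoc)
  also have "(\<Prod>i=1..b - a + 1. f (i + 2)) = V1prod y a b"
    by (simp add: V1prod_def f_def algebra_simps)
  finally show ?thesis
    by (simp add: f_def algebra_simps)
qed

lemma V1prod_rec4:
  assumes "a \<le> b + 1"
  shows "V1prod y a (b + 4) = y (nat (b + 4)) * (1 + y (nat (b + 3))) *
    (y (nat (b + 2)) * (1 + y (nat (b + 1)))) * V1prod y a b"
  using V1prod_rec2 [of a "b + 2" y] V1prod_rec2 [of a b y] assms
  by (simp add: add.assoc mult.assoc)

section \<open>The expansion (\<open>F\<close> in the overview), its new terms (\<open>E\<close>)
  and their recurrences\<close>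

definition expansion :: "(nat \<Rightarrow> 'a::comm_ring_1) \<Rightarrow> int \<Rightarrow> 'a" where
  "expansion y t =
    (\<Sum>j=0..(t - 3) div 4. \<Sum>i=-1..t - 4 * j - 4.
        Pprod y 1 i * V1prod y (i + 2) (i + 3 + 4 * j) * Uprod y (i + 5 + 4 * j) t)
    + (\<Sum>i=0..(t - 2) div 4. V1prod y 1 (4 * i + 1) * Uprod y (4 * i + 3) t)"

text \<open>The part of the expansion at \<open>t\<close> formed by the terms whose factor \<open>U\<close> is empty.\<close>

definition new_terms :: "(nat \<Rightarrow> 'a::comm_ring_1) \<Rightarrow> int \<Rightarrow> 'a" where
  "new_terms y t =
    (\<Sum>j=0..(t - 3) div 4. Pprod y 1 (t - 4 * j - 4) * V1prod y (t - 4 * j - 2) (t - 1))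
    + (if t mod 4 = 2 then V1prod y 1 (t - 1) else 0)"

text \<open>Each term present at \<open>t\<close> gains the factor \<open>y (nat (t + 1))\<close>
  through \<open>Uprod\<close>. The new terms have \<open>i = t - 4 * j - 3\<close> in the double
  sum and, if \<open>t + 1\<close> is 2 modulo 4, \<open>4 * i + 3 = t + 2\<close> in the single
  sum.\<close>

lemma expansion_step:
  assumes "t \<ge> 0"
  shows "expansion y (t + 1) = y (nat (t + 1)) * expansion y t + new_terms y (t + 1)"
proof -
  let ?A = "\<lambda>j i s. Pprod y 1 i * V1prod y (i + 2) (i + 3 + 4 * j) * Uprod y (i + 5 + 4 * j) s"
  let ?B = "\<lambda>i s. V1prod y 1 (4 * i + 1) * Uprod y (4 * i + 3) s"
  have inner: "(\<Sum>i=-1..t + 1 - 4 * j - 4. ?A j i (t + 1)) =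
      y (nat (t + 1)) * (\<Sum>i=-1..t - 4 * j - 4. ?A j i t)
      + Pprod y 1 (t + 1 - 4 * j - 4) * V1prod y (t + 1 - 4 * j - 2) (t + 1 - 1)"
    if "j \<in> {0..(t + 1 - 3) div 4}" for j
  proof -
    have "-1 \<le> t - 4 * j - 3"
      using that by auto
    then have "{-1..t + 1 - 4 * j - 4} = insert (t - 4 * j - 3) {-1..t - 4 * j - 4}"
      by auto
    moreover have "?A j i (t + 1) = y (nat (t + 1)) * ?A j i t" if "i \<in> {-1..t - 4 * j - 4}" for i
      using that Uprod_rec [of "i + 5 + 4 * j" t y] by (simp add: ac_simps)
    ultimately show ?thesis
      by (simp add: sum_distrib_left Uprod_empty)
  qed
  \<comment> \<open>The upper limit may rise by one, but for that \<open>j\<close> the inner range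
    is empty.\<close>
  have "(\<Sum>j=0..(t - 3) div 4. \<Sum>i=-1..t - 4 * j - 4. ?A j i t) =
      (\<Sum>j=0..(t + 1 - 3) div 4. \<Sum>i=-1..t - 4 * j - 4. ?A j i t)"
    by (rule sum.mono_neutral_left) auto
  moreover have "(\<Sum>j=0..(t + 1 - 3) div 4. \<Sum>i=-1..t + 1 - 4 * j - 4. ?A j i (t + 1)) =
      y (nat (t + 1)) * (\<Sum>j=0..(t + 1 - 3) div 4. \<Sum>i=-1..t - 4 * j - 4. ?A j i t)
      + (\<Sum>j=0..(t + 1 - 3) div 4.
          Pprod y 1 (t + 1 - 4 * j - 4) * V1prod y (t + 1 - 4 * j - 2) (t + 1 - 1))"
    unfolding sum_distrib_left [where A = "{0.._}"] sum.distrib [symmetric]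
    by (rule sum.cong [OF refl inner])
  ultimately have first: "(\<Sum>j=0..(t + 1 - 3) div 4. \<Sum>i=-1..t + 1 - 4 * j - 4. ?A j i (t + 1)) =
      y (nat (t + 1)) * (\<Sum>j=0..(t - 3) div 4. \<Sum>i=-1..t - 4 * j - 4. ?A j i t)
      + (\<Sum>j=0..(t + 1 - 3) div 4.
          Pprod y 1 (t + 1 - 4 * j - 4) * V1prod y (t + 1 - 4 * j - 2) (t + 1 - 1))"
    by (simp only:)
  have old: "(\<Sum>i=0..(t - 2) div 4. ?B i (t + 1)) = y (nat (t + 1)) * (\<Sum>i=0..(t - 2) div 4. ?B i t)"
    unfolding sum_distrib_left
  proof (rule sum.cong [OF refl])
    fix i
    assume "i \<in> {0..(t - 2) div 4}"
    then
    have "4 * i + 3 \<le> t + 1"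
      by auto
    then show "?B i (t + 1) = y (nat (t + 1)) * ?B i t"
      using Uprod_rec [of "4 * i + 3" t y] by (simp add: ac_simps)
  qed
  have second: "(\<Sum>i=0..(t + 1 - 2) div 4. ?B i (t + 1)) =
      y (nat (t + 1)) * (\<Sum>i=0..(t - 2) div 4. ?B i t)
      + (if (t + 1) mod 4 = 2 then V1prod y 1 (t + 1 - 1) else 0)"
  proof (cases "(t + 1) mod 4 = 2")
    case True
    define q where "q = t div 4"
    then have q: "t = 4 * q + 1"
      using True by presburger
    then have "{0..(t + 1 - 2) div 4} = insert q {0..(t - 2) div 4}"
      using assms by auto
    moreover have "q \<notin> {0..(t - 2) div 4}"
      using q by auto
    ultimately have "(\<Sum>i=0..(t + 1 - 2) div 4. ?B i (t + 1)) =
        ?B q (t + 1) + (\<Sum>i=0..(t - 2) div 4. ?B i (t + 1))"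
      by (simp only: sum.insert finite_atLeastAtMost_int not_False_eq_True)
    then show ?thesis
      unfolding old using True q by (simp add: Uprod_empty add.commute)
  next
    case False
    \<comment> \<open>The limits \<open>(t - 1) div 4\<close> and \<open>(t - 2) div 4\<close>
      differ only if 4 divides \<open>t - 1\<close>.\<close>
    then have "(t - 1) mod 4 \<noteq> 0"
      by presburger
    then have "0 < (t - 1) mod 4"
      by (simp add: order_less_le)
    then have "(t - 2) div 4 = (t - 1) div 4"
      by (intro int_div_pos_eq [where r = "(t - 1) mod 4 - 1"]) auto
    then show ?thesis
      using False old by simp
  qed
  show ?thesis
    unfolding expansion_def new_terms_def first second by (simp add: algebra_simps)
qed

text \<open>Summand \<open>j + 1\<close> at \<open>t + 4\<close> has the \<open>Pprod\<close> of
  summand \<open>j\<close> at \<open>t\<close> and a \<open>V1prod\<close> with four more factors at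
  the top; the residue of \<open>t\<close> modulo 4 is unchanged. The new summand
  \<open>j = 0\<close> contributes \<open>Pprod y 1 t\<close>.\<close>

lemma new_terms_rec4:
  assumes "t \<ge> 1"
  shows "new_terms y (t + 4) = y (nat (t + 3)) * (1 + y (nat (t + 2))) *
    (Pprod y 1 t + y (nat (t + 1)) * (1 + y (nat t)) * new_terms y t)"
proof -
  let ?f = "\<lambda>t j. Pprod y 1 (t - 4 * j - 4) * V1prod y (t - 4 * j - 2) (t - 1)"
  let ?c = "y (nat (t + 3)) * (1 + y (nat (t + 2)))"
  let ?d = "y (nat (t + 1)) * (1 + y (nat t))"
  have V: "V1prod y a (t + 3) = ?c * ?d * V1prod y a (t - 1)" if "a \<le> t" for a
    using V1prod_rec4 [of a "t - 1" y] that by (simp add: ac_simps)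
  have zero_notin: "0 \<notin> (\<lambda>j. j + 1) ` {0..(t - 3) div 4}"
    by auto
  have "{0..(t + 4 - 3) div 4} = insert 0 ((\<lambda>j. j + 1) ` {0..(t - 3) div 4})"
    using assms by (auto simp: image_def intro!: bexI [of _ "_ - 1"])
  moreover have "(\<Sum>j\<in>(\<lambda>j. j + 1) ` {0..(t - 3) div 4}. ?f (t + 4) j) =
      (\<Sum>j=0..(t - 3) div 4. ?f (t + 4) (j + 1))"
    by (rule sum.reindex [where h = "\<lambda>j. j + 1", unfolded o_def]) simp
  ultimately have "(\<Sum>j=0..(t + 4 - 3) div 4. ?f (t + 4) j) =
      ?f (t + 4) 0 + (\<Sum>j=0..(t - 3) div 4. ?f (t + 4) (j + 1))"
    using zero_notin by (simp only: sum.insert finite_imageI finite_atLeastAtMost_int not_False_eq_True)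
  also have "?f (t + 4) 0 = ?c * Pprod y 1 t"
    using V1prod_rec2 [of "t + 2" "t + 1" y] by (simp add: V1prod_empty ac_simps)
  also have "(\<Sum>j=0..(t - 3) div 4. ?f (t + 4) (j + 1)) =
      ?c * ?d * (\<Sum>j=0..(t - 3) div 4. ?f t j)"
    unfolding sum_distrib_left
  proof (rule sum.cong [OF refl])
    fix j
    assume "j \<in> {0..(t - 3) div 4}"
    then show "?f (t + 4) (j + 1) = ?c * ?d * ?f t j"
      using V [of "t - 4 * j - 2"] by (simp add: algebra_simps)
  qed
  finally show ?thesis
    using V [of 1] assms by (simp add: new_terms_def algebra_simps)
qed

lemma new_terms_rec2:
  fixes y :: "nat \<Rightarrow> 'a::boolean_ring"
  assumes "t \<ge> 1"
  shows "new_terms y (int t + 2) =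
    y (t + 1) * (prefix_prod y t + (1 + y t) * new_terms y (int t))"
  using assms
proof (induction t rule: less_induct)
  case (less t)
  consider "t = 1" | "t = 2" | "t \<ge> 3"
    using less.prems by linarith
  then show ?case
  proof cases
    case 1
    then show ?thesis
      using V1prod_rec2 [of 1 0 y]
      by (simp add: new_terms_def Pprod_empty V1prod_empty numeral_eq_Suc)
  next
    case 2
    then show ?thesis
      using V1prod_rec2 [of 2 1 y]
      by (simp add: new_terms_def Pprod_empty V1prod_empty V1prod_single numeral_eq_Suc algebra_simps)
  next
    case 3
    define s where "s = t - 2"
    with 3 have s: "t = s + 2" "s \<ge> 1" "s < t"
      by simp_all
    have rec4: "new_terms y (int s + 4) = y (s + 3) * (1 + y (s + 2)) *
        (prefix_prod y s + y (s + 1) * (1 + y s) * new_terms y (int s))"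
      using new_terms_rec4 [of "int s" y] s
      by (simp add: nat_add_distrib Pprod_eq_prefix_prod)
    \<comment> \<open>The induction hypothesis solved for this product, by adding in characteristic
      2. Substituted into \<open>rec4\<close>, its last term turns \<open>prefix_prod y s\<close>
      into \<open>prefix_prod y (s + 1)\<close>.\<close>
    have rec2: "y (s + 1) * (1 + y s) * new_terms y (int s) =
        new_terms y (int s + 2) + y (s + 1) * prefix_prod y s"
      using less.IH [of s] s by (simp add: algebra_simps)
    have "new_terms y (int s + 4) = y (s + 3) * (1 + y (s + 2)) *
        (prefix_prod y (s + 1) + new_terms y (int s + 2))"
      unfolding rec4 rec2
      by (simp add: algebra_simps)
    also have "\<dots> = y (s + 3) * (prefix_prod y (s + 2) + (1 + y (s + 2)) * new_terms y (int s + 2))"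
      by (simp add: algebra_simps)
    finally show ?thesis
      unfolding s(1) by (simp add: eval_nat_numeral add.commute)
  qed
qed

section \<open>Identification of \<open>delta1\<close> with the expansion\<close>

lemma new_terms_Suc:
  fixes y :: "nat \<Rightarrow> 'a::boolean_ring"
  assumes "t \<ge> 1"
  shows "new_terms y (int t + 1) =
    gamma y (t + 1) + y t * (expansion y (int t - 1) + new_terms y (int t))"
  using assms
proof (induction t rule: dec_induct)
  case base
  then show ?case
    using gamma_Suc [of 1 y]
    by (simp add: new_terms_def expansion_def V1prod_single gamma_def)
next
  case (step t)
  have "y (Suc t) * expansion y (int t) =
      y (Suc t) * (y t * expansion y (int t - 1) + new_terms y (int t))"
    using expansion_step [of "int t - 1" y] step by simp
  \<comment> \<open>The induction hypothesis, solved for this product. In the goal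
    \<open>new_terms y (int t + 1)\<close> then cancels, and \<open>gamma_Suc\<close> reduces the
    rest to \<open>new_terms_rec2\<close>.\<close>
  also have "y t * expansion y (int t - 1) =
      new_terms y (int t + 1) + gamma y (t + 1) + y t * new_terms y (int t)"
    using step by (simp add: algebra_simps)
  finally show ?case
    using new_terms_rec2 [of t y] gamma_Suc [of "t + 1" y] step
    by (simp add: algebra_simps)
qed

lemma delta1_eq_expansion:
  fixes y :: "nat \<Rightarrow> 'a::boolean_ring"
  assumes "t \<ge> 1"
  shows "delta1 y t = expansion y (int t)"
  using assms
proof (induction t rule: dec_induct)
  case base
  then show ?case
    by (simp add: delta1_def gamma_def expansion_def)
next
  case (step t)
  have "expansion y (int t) = y t * expansion y (int t - 1) + new_terms y (int t)"
    using expansion_step [of "int t - 1" y] step by simp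
  moreover have "expansion y (int (Suc t)) =
      y (Suc t) * expansion y (int t) + new_terms y (int t + 1)"
    using expansion_step [of "int t" y] by (simp add: ac_simps nat_add_distrib)
  \<comment> \<open>By idempotency \<open>y t * expansion y (int t)\<close> equals
    \<open>y t * (expansion y (int t - 1) + new_terms y (int t))\<close>, the product in
    \<open>new_terms_Suc\<close>.\<close>
  ultimately show ?case
    using step new_terms_Suc [of t y] by (simp add: delta1_Suc algebra_simps)
qed

theorem corollary1:
  fixes y :: "nat \<Rightarrow> 'n::finite boolean_poly" and t :: nat
  assumes "t \<ge> 1"
  shows "delta1 y t =
    (\<Sum>j=0..\<lfloor>(real t - 3) / 4\<rfloor>. \<Sum>i=-1..int t - 4 * j - 4.
        Pprod y 1 i * V1prod y (i + 2) (i + 3 + 4 * j) * Uprod y (i + 5 + 4 * j) (int t))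
    + (\<Sum>i=0..\<lfloor>(real t - 2) / 4\<rfloor>.
        V1prod y 1 (4 * i + 1) * Uprod y (4 * i + 3) (int t))"
proof -
  \<comment> \<open>Integer \<open>div\<close> also rounds down for the negative numerators that
    occur at \<open>t = 1\<close> and \<open>t = 2\<close>.\<close>
  have "\<lfloor>(real t - real k) / 4\<rfloor> = (int t - int k) div 4" for k
    using floor_divide_of_int_eq [of "int t - int k" 4, where 'a = real] by simp
  from this [of 3] this [of 2] show ?thesis
    using delta1_eq_expansion [OF assms, of y] by (simp add: expansion_def)
qed

end
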